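(* Let $L$ be a finite lattice. Then $L$ is matroidal if and only if $L$ is a linear order, i.e. $L\cong[n]$ (as a poset) for some integer $n\ge 0$.
   Context: Lattices are nonempty. For $n\ge 0$, $[n]$ denotes the linearly ordered set $\{0<1<\dots<n\}$. For a finite lattice $L$ with order $\le$ and meet $\wedge$, $L^\to$ denotes the set of nontrivial edges of $L$, i.e. pairs $(x\to y)$ with $x,y\in L$, $x\le y$ and $x\ne y$. A transfer system on $L$ is a partial order $T$ on the set $L$ that is contained in $\le$ (so $T$ is reflexive, transitive, and $x\,T\,y$ implies $x\le y$) and is closed under restriction: if $x\,T\,y$ and $z\in L$, then $(x\wedge z)\,T\,(y\wedge z)$. For every set $S\subseteq L^\to$ there is a smallest transfer system containing $S$, called the transfer system generated by $S$. A set $S\subseteq L^\to$ is a minimal generating set if no proper subset of $S$ generates the same transfer system as $S$. $\mathrm{MGS}(L)\subseteq\mathcal P(L^\to)$ denotes the collection of all minimal generating sets (of all transfer systems on $L$). A matroid is a pair $(E,I)$ with $E$ a finite set and $I\subseteq\mathcal P(E)$ such that: (1) $\emptyset\in I$; (2) if $A\subseteq B$ and $B\in I$, then $A\in I$; (3) if $A,B\in I$ with $|A|<|B|$, then there is some $b\in B\setminus A$ such that $A\cup\{b\}\in I$. The lattice $L$ is called matroidal if the pair $(L^\to,\mathrm{MGS}(L))$ is a matroid. *)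

theory Defs
  imports Main
begin

text \<open>A lattice is rendered as a type of class \<^class>\<open>lattice\<close>, so nonemptiness is automatic.\<close>

definition edges :: "('a::lattice \<times> 'a) set" where
  "edges = {(x, y). x \<le> y \<and> x \<noteq> y}"

definition transfer_system :: "('a::lattice \<times> 'a) set \<Rightarrow> bool" where
  "transfer_system T \<longleftrightarrow>
     partial_order_on UNIV T \<and>
     (\<forall>x y. (x, y) \<in> T \<longrightarrow> x \<le> y) \<and>
     (\<forall>x y z. (x, y) \<in> T \<longrightarrow> (inf x z, inf y z) \<in> T)"

text \<open>The intersection below is the smallest transfer system containing \<open>S\<close> whenever
  \<open>S \<subseteq> edges\<close>; see \<open>generated_least\<close>.\<close>

definition generated :: "('a::lattice \<times> 'a) set \<Rightarrow> ('a \<times> 'a) set" where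
  "generated S = \<Inter>{T. transfer_system T \<and> S \<subseteq> T}"

lemma transfer_system_le: "transfer_system {(x::'a::lattice, y). x \<le> y}"
  unfolding transfer_system_def partial_order_on_def preorder_on_def
    refl_on_def antisym_def trans_def
  by (auto intro: le_infI1)

lemma generated_least:
  fixes S :: "('a::lattice \<times> 'a) set"
  assumes "S \<subseteq> edges"
  shows "transfer_system (generated S)"
    and "S \<subseteq> generated S"
    and "transfer_system T \<Longrightarrow> S \<subseteq> T \<Longrightarrow> generated S \<subseteq> T"
proof -
  have sub: "generated S \<subseteq> {(x, y). x \<le> y}"
    using assms transfer_system_le unfolding generated_def edges_def by blast
  show "transfer_system (generated S)"
    unfolding transfer_system_def partial_order_on_def preorder_on_def
  proof (intro conjI allI impI)
    show "refl (generated S)"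
      unfolding generated_def transfer_system_def partial_order_on_def preorder_on_def refl_on_def
      by blast
    show "trans (generated S)"
      unfolding generated_def transfer_system_def partial_order_on_def preorder_on_def trans_def
      by blast
    show "antisym (generated S)"
      using sub by (auto simp: subset_iff intro!: antisymI order.antisym)
    show "x \<le> y" if "(x, y) \<in> generated S" for x y
      using sub that by blast
    show "(inf x z, inf y z) \<in> generated S" if "(x, y) \<in> generated S" for x y z
      using that unfolding generated_def transfer_system_def by blast
  qed auto
  show "S \<subseteq> generated S" unfolding generated_def by blast
  show "generated S \<subseteq> T" if "transfer_system T" "S \<subseteq> T"
    using that unfolding generated_def by blast
qed

definition MGS :: "('a::lattice \<times> 'a) set set" where
  "MGS = {S. S \<subseteq> edges \<and> (\<forall>S'. S' \<subset> S \<longrightarrow> generated S' \<noteq> generated S)}"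

definition matroid :: "'e set \<Rightarrow> 'e set set \<Rightarrow> bool" where
  "matroid E I \<longleftrightarrow>
     finite E \<and> I \<subseteq> Pow E \<and>
     {} \<in> I \<and>
     (\<forall>A B. A \<subseteq> B \<longrightarrow> B \<in> I \<longrightarrow> A \<in> I) \<and>
     (\<forall>A B. A \<in> I \<longrightarrow> B \<in> I \<longrightarrow> card A < card B \<longrightarrow> (\<exists>b \<in> B - A. insert b A \<in> I))"

definition matroidal :: "'a::lattice itself \<Rightarrow> bool" where
  "matroidal (_ :: 'a itself) \<longleftrightarrow> matroid (edges :: ('a \<times> 'a) set) MGS"

end

(* On a chain, restricting an edge (a, b) either trivialises it or shortens it to some (a, b') with
   the same source. Hence a set of edges is a minimal generating set iff its edges have
   pairwise distinct sources, which gives a partition matroid. Conversely, if x and y are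
   incomparable, the edge (inf x y, x) is a restriction of both (inf x y, sup x y) and (y, sup x y),
   while neither of these two generates the other. So being parallel is not transitive,
   and exchange fails. *)
theory Submission
  imports Defs
begin

lemma generated_subset:
  "transfer_system T \<Longrightarrow> S \<subseteq> T \<Longrightarrow> generated S \<subseteq> T"
  unfolding generated_def by blast

lemma subset_generated: "S \<subseteq> generated S"
  unfolding generated_def by blast

lemma generated_mono: "S \<subseteq> S' \<Longrightarrow> generated S \<subseteq> generated S'"
  unfolding generated_def by blast

lemma generated_restrict:
  "(x, y) \<in> generated S \<Longrightarrow> (inf x z, inf y z) \<in> generated S"
  unfolding generated_def transfer_system_def by blast

lemma generated_cong:
  assumes "S \<subseteq> generated S'" "S' \<subseteq> generated S"
  shows "generated S = generated S'"
  using assms unfolding generated_def by blast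

text \<open>A proper subset generating the same system omits some \<open>e\<close>, and by
  monotonicity \<open>S - {e}\<close> then already generates \<open>e\<close>. So it suffices to
  test the deletion of single edges.\<close>

lemma MGS_iff:
  "S \<in> MGS \<longleftrightarrow> S \<subseteq> edges \<and> (\<forall>e \<in> S. e \<notin> generated (S - {e}))"
proof -
  have "(\<forall>S'. S' \<subset> S \<longrightarrow> generated S' \<noteq> generated S)
    \<longleftrightarrow> (\<forall>e \<in> S. e \<notin> generated (S - {e}))"
  proof (intro iffI allI impI ballI notI)
    fix e assume min: "\<forall>S'. S' \<subset> S \<longrightarrow> generated S' \<noteq> generated S"
      and e: "e \<in> S" "e \<in> generated (S - {e})"
    have "generated (S - {e}) = generated S"
      using e subset_generated[of S] subset_generated[of "S - {e}"]
      by (intro generated_cong) blast+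
    with min e(1) show False by blast
  next
    fix S' assume irr: "\<forall>e \<in> S. e \<notin> generated (S - {e})"
      and S': "S' \<subset> S" "generated S' = generated S"
    from S'(1) obtain e where e: "e \<in> S" "S' \<subseteq> S - {e}" by blast
    then have "e \<in> generated (S - {e})"
      using S'(2) subset_generated[of S] generated_mono[OF e(2)] by blast
    with irr e(1) show False by blast
  qed
  then show ?thesis unfolding MGS_def by blast
qed

text \<open>\<open>Id\<close> is a transfer system, so the empty set generates only trivial
  pairs.\<close>

lemma MGS_singleton:
  assumes "e \<in> edges"
  shows "{e} \<in> MGS"
proof -
  have "transfer_system Id"
    unfolding transfer_system_def partial_order_on_def preorder_on_def
    by (auto simp: refl_on_def antisym_def trans_def)
  then have "generated {} \<subseteq> Id" by (rule generated_subset) simp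
  with assms show ?thesis unfolding MGS_iff edges_def by auto
qed

lemma MGS_pair_iff:
  assumes "e \<noteq> f"
  shows "{e, f} \<in> MGS \<longleftrightarrow>
    e \<in> edges \<and> f \<in> edges \<and> e \<notin> generated {f} \<and> f \<notin> generated {e}"
proof -
  have "{e, f} - {e} = {f}" "{e, f} - {f} = {e}" using assms by auto
  then show ?thesis unfolding MGS_iff by auto
qed

text \<open>Meets only lower a source, so a source not above \<open>y\<close> stays so, and a
  composite keeps its first source. With \<open>y\<close> incomparable to \<open>x\<close>, this
  system contains \<open>(inf x y, sup x y)\<close> but not \<open>(y, sup x y)\<close>.\<close>

lemma transfer_system_not_above:
  "transfer_system {(a, b). a = b \<or> a \<le> b \<and> \<not> y \<le> (a :: 'a::lattice)}"
  unfolding transfer_system_def partial_order_on_def preorder_on_def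
  by (auto simp: refl_on_def antisym_def trans_def intro: le_infI1)

text \<open>For \<open>a \<le> b\<close> the condition amounts to \<open>inf a y = inf b y\<close>,
  so this is the order intersected with the kernel of meeting with \<open>y\<close>. It contains
  \<open>(y, sup x y)\<close>, but contains \<open>(inf x y, sup x y)\<close> only if
  \<open>y \<le> x\<close>.\<close>

lemma transfer_system_inf_le:
  "transfer_system {(a, b). a \<le> b \<and> inf b y \<le> (a :: 'a::lattice)}"
proof -
  have "inf c y \<le> a" if "inf b y \<le> a" "inf c y \<le> b" for a b c :: 'a
    using that by (meson inf_le2 le_inf_iff order_trans)
  moreover have "inf (inf b z) y \<le> inf a z" if "inf b y \<le> a" for a b z :: 'a
    using that by (metis inf.commute inf.left_commute inf_mono order_refl)
  ultimately show ?thesis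
    unfolding transfer_system_def partial_order_on_def preorder_on_def
    by (auto simp: refl_on_def antisym_def trans_def intro: le_infI1)
qed

lemma matroidal_imp_comparable:
  fixes x y :: "'a::lattice"
  assumes "matroidal TYPE('a)"
  shows "x \<le> y \<or> y \<le> x"
proof (rule ccontr)
  assume incomp: "\<not> (x \<le> y \<or> y \<le> x)"
  define e f g where "e = (inf x y, x)" and "f = (inf x y, sup x y)" and "g = (y, sup x y)"
  have ne: "y \<noteq> sup x y" "x \<noteq> inf x y" "inf x y \<noteq> y" "x \<noteq> sup x y" "inf x y \<noteq> sup x y"
    using incomp by (metis inf_le1 inf_le2 sup_ge1 sup_ge2 order_trans)+
  then have edge: "e \<in> edges" "f \<in> edges" "g \<in> edges"
    unfolding e_def f_def g_def edges_def by (auto simp: le_supI1)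
  have distinct: "e \<noteq> f" "e \<noteq> g" "f \<noteq> g"
    using ne unfolding e_def f_def g_def by auto
  have "e \<in> generated {f}"
    using generated_restrict[of "inf x y" "sup x y" "{f}" x] subset_generated[of "{f}"]
    by (simp add: e_def f_def inf.absorb1 inf.absorb2)
  then have ef: "{e, f} \<notin> MGS" by (simp add: MGS_pair_iff distinct)
  have "e \<in> generated {g}"
    using generated_restrict[of y "sup x y" "{g}" x] subset_generated[of "{g}"]
    by (simp add: e_def g_def inf.absorb2 inf.commute[of y x])
  then have eg: "{e, g} \<notin> MGS" by (simp add: MGS_pair_iff distinct)
  have "g \<notin> generated {f}"
    using generated_subset[OF transfer_system_not_above[of y], of "{f}"] incomp ne
    unfolding f_def g_def by (auto simp: le_supI1)
  moreover have "f \<notin> generated {g}"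
    using generated_subset[OF transfer_system_inf_le[of y], of "{g}"] incomp
    unfolding f_def g_def by (auto simp: inf.absorb2)
  ultimately have fg: "{f, g} \<in> MGS" by (simp add: MGS_pair_iff distinct edge)
  \<comment> \<open>Exchange would have to enlarge \<open>{e}\<close> by \<open>f\<close> or
    \<open>g\<close>, but each of these generates \<open>e\<close>.\<close>
  have "card {e} < card {f, g}" using distinct by simp
  then obtain b where "b \<in> {f, g} - {e}" "insert b {e} \<in> MGS"
    using assms MGS_singleton[OF edge(1)] fg unfolding matroidal_def matroid_def by meson
  then show False using ef eg by (auto simp: insert_commute)
qed

lemma MGS_chain:
  assumes total: "\<And>x y :: 'a::lattice. x \<le> y \<or> y \<le> x"
  shows "MGS = {S :: ('a \<times> 'a) set. S \<subseteq> edges \<and> inj_on fst S}"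
proof (intro set_eqI iffI)
  fix S :: "('a \<times> 'a) set"
  assume S: "S \<in> MGS"
  have "b = c" if ab: "(a, b) \<in> S" and ac: "(a, c) \<in> S" and bc: "b \<le> c" for a b c
  proof (rule ccontr)
    assume "b \<noteq> c"
    then have "(a, c) \<in> generated (S - {(a, b)})"
      using ac by (intro subsetD[OF subset_generated]) simp
    moreover have "a \<le> b" using S ab unfolding MGS_iff edges_def by auto
    \<comment> \<open>Meeting the longer edge \<open>(a, c)\<close> with \<open>b\<close> cuts it
      down to \<open>(a, b)\<close>.\<close>
    ultimately have "(a, b) \<in> generated (S - {(a, b)})"
      using generated_restrict[of a c _ b] bc by (simp add: inf.absorb1 inf.absorb2)
    with S ab show False unfolding MGS_iff by blast
  qed
  then have "inj_on fst S" using total unfolding inj_on_def by (metis prod.collapse)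
  with S show "S \<in> {S. S \<subseteq> edges \<and> inj_on fst S}" unfolding MGS_iff by blast
next
  fix S :: "('a \<times> 'a) set"
  assume "S \<in> {S. S \<subseteq> edges \<and> inj_on fst S}"
  then have S: "S \<subseteq> edges" "inj_on fst S" by auto
  have "(a, b) \<notin> generated (S - {(a, b)})" if ab: "(a, b) \<in> S" for a b
  proof -
    \<comment> \<open>\<open>?T\<close> omits exactly the nontrivial edges with source
      \<open>a\<close>. It is closed under restriction because in a chain meeting an edge with
      \<open>z\<close> either collapses it or keeps its source.\<close>
    let ?T = "{(u, v). u = v \<or> u \<le> v \<and> u \<noteq> a}"
    have "inf u z = inf v z \<or> inf u z = u" if "u \<le> v" for u v z :: 'a
      using total[of u z] that by (metis inf.absorb1 inf.absorb2 order_trans)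
    then have "inf u z = inf v z \<or> inf u z \<noteq> a" if "u \<le> v" "u \<noteq> a" for u v z :: 'a
      using that by metis
    then have "transfer_system ?T"
      unfolding transfer_system_def partial_order_on_def preorder_on_def
      by (auto simp: refl_on_def antisym_def trans_def intro: le_infI1)
    moreover have "S - {(a, b)} \<subseteq> ?T"
    proof
      fix p assume p: "p \<in> S - {(a, b)}"
      then have "fst p \<noteq> a" using S(2) ab unfolding inj_on_def by fastforce
      with p S(1) show "p \<in> ?T" unfolding edges_def by auto
    qed
    ultimately have "generated (S - {(a, b)}) \<subseteq> ?T" by (rule generated_subset)
    then show ?thesis using S(1) ab unfolding edges_def by auto
  qed
  with S(1) show "S \<in> MGS" unfolding MGS_iff by auto
qed

text \<open>This is the partition matroid whose blocks are the fibres of \<open>f\<close>, each of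
  capacity one. For exchange, the larger set has more image points, so it meets a fibre that the
  smaller one misses.\<close>

lemma matroid_inj_on:
  assumes "finite E"
  shows "matroid E {S. S \<subseteq> E \<and> inj_on f S}"
  unfolding matroid_def
proof (intro conjI allI impI)
  fix A B
  assume A: "A \<in> {S. S \<subseteq> E \<and> inj_on f S}" and B: "B \<in> {S. S \<subseteq> E \<and> inj_on f S}"
    and less: "card A < card B"
  have "finite (f ` A)" using A assms by (auto dest: finite_subset)
  moreover have "card (f ` A) < card (f ` B)" using A B less by (simp add: card_image)
  ultimately have "\<not> f ` B \<subseteq> f ` A" using card_mono leD by blast
  then obtain b where "b \<in> B" "f b \<notin> f ` A" by blast
  then show "\<exists>b \<in> B - A. insert b A \<in> {S. S \<subseteq> E \<and> inj_on f S}"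
    using A B by (intro bexI[of _ b]) auto
qed (use assms in \<open>auto intro: inj_on_subset\<close>)

lemma total_finite_order_isomorphism:
  assumes total: "\<And>x y :: 'a::{finite, order}. x \<le> y \<or> y \<le> x"
  shows "\<exists>(n::nat) (f :: 'a \<Rightarrow> nat). bij_betw f UNIV {0..n} \<and> (\<forall>x y. x \<le> y \<longleftrightarrow> f x \<le> f y)"
proof -
  \<comment> \<open>The rank of \<open>x\<close> in the chain, counted from 0.\<close>
  define f where "f = (\<lambda>x :: 'a. card {z. z < x})"
  have strict: "f x < f y" if "x < y" for x y
  proof -
    have "{z. z < x} \<subset> {z. z < y}" using that by auto
    then show ?thesis unfolding f_def by (intro psubset_card_mono) auto
  qed
  then have le: "x \<le> y \<longleftrightarrow> f x \<le> f y" for x y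
    using total by (metis leD le_less less_le_not_le)
  then have inj: "inj f" by (auto intro!: injI order.antisym)
  have "f x < card (UNIV :: 'a set)" for x
    unfolding f_def by (intro psubset_card_mono) auto
  \<comment> \<open>The type is nonempty, so the truncated subtraction is exact. The injective
    \<open>f\<close> thus maps into an interval of the same size and must fill it.\<close>
  then have "f x \<le> card (UNIV :: 'a set) - 1" for x
    by (metis Suc_diff_1 finite_UNIV_card_ge_0 finite less_Suc_eq_le)
  then have "range f \<subseteq> {0..card (UNIV :: 'a set) - 1}" by auto
  moreover have "card (range f) = card {0..card (UNIV :: 'a set) - 1}"
    by (simp add: card_image[OF inj] card_gt_0_iff)
  ultimately have "range f = {0..card (UNIV :: 'a set) - 1}"
    by (intro card_subset_eq) auto
  with inj le show ?thesis unfolding bij_betw_def by blast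
qed

theorem theorem1p5:
  shows "matroidal TYPE('a::{finite, lattice}) \<longleftrightarrow>
    (\<exists>(n::nat) (f :: 'a \<Rightarrow> nat). bij_betw f UNIV {0..n} \<and> (\<forall>x y. x \<le> y \<longleftrightarrow> f x \<le> f y))"
proof
  assume "matroidal TYPE('a)"
  then show "\<exists>n (f :: 'a \<Rightarrow> nat). bij_betw f UNIV {0..n} \<and> (\<forall>x y. x \<le> y \<longleftrightarrow> f x \<le> f y)"
    by (intro total_finite_order_isomorphism matroidal_imp_comparable)
next
  assume "\<exists>n (f :: 'a \<Rightarrow> nat). bij_betw f UNIV {0..n} \<and> (\<forall>x y. x \<le> y \<longleftrightarrow> f x \<le> f y)"
  then have "x \<le> y \<or> y \<le> x" for x y :: 'a by (metis nat_le_linear)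
  then show "matroidal TYPE('a)"
    \<comment> \<open>The blocks of the partition matroid are here the sets of edges with a common
      source.\<close>
    unfolding matroidal_def by (simp add: MGS_chain matroid_inj_on)
qed

end
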